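(* Let $(x,u)\in\Gamma_\tau$, write $\mathfrak{D}=(x,u)$, and let $(X_{\mathrm d},X,U)$ be the synthesis operator triple associated with $(x,u)$. Then for all $(A,B)\in\Sigma_{n,m}$, one has $(A,B)\in\Sigma_{\mathfrak{D}}$ if and only if $X_{\mathrm d}=AX+BU$ (as operators from $\mathrm{H}^1_0[0,\tau]$ to $\mathbb{R}^n$).
   Context: Fix $\tau>0$ and positive integers $n,m$. $\mathrm{L}^2([0,\tau];\mathbb{R}^n)$ is the space of (classes of) square-integrable measurable functions $[0,\tau]\to\mathbb{R}^n$; $\mathrm{H}^1([0,\tau];\mathbb{R}^n)$ is the space of absolutely continuous functions $\phi:[0,\tau]\to\mathbb{R}^n$ with $\phi'\in\mathrm{L}^2([0,\tau];\mathbb{R}^n)$; $\mathrm{H}^1_0[0,\tau]$ is the space of scalar functions $\phi\in \mathrm{H}^1([0,\tau];\mathbb{R})$ with $\phi(0)=\phi(\tau)=0$, a Hilbert space with inner product $\langle\phi,\psi\rangle_{\mathrm{H}^1_0}=\int_0^\tau\phi'(t)\psi'(t)\,dt$. $\Gamma_\tau=\{(x,u): x\in\mathrm{H}^1([0,\tau];\mathbb{R}^n),\ u\in\mathrm{L}^2([0,\tau];\mathbb{R}^m)\}$ (data set) and $\Sigma_{n,m}=\{(A,B):A\in\mathbb{R}^{n\times n},\ B\in\mathbb{R}^{n\times m}\}$ (system set). For $f\in\mathrm{L}^2([0,\tau];\mathbb{R}^k)$, the synthesis operator $F$ and the differentiated synthesis operator $F_{\mathrm d}$ associated with $f$ are the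 bounded linear operators $\mathrm{H}^1_0[0,\tau]\to\mathbb{R}^k$ given by $F\phi=\int_0^\tau\phi(t)f(t)\,dt$ and $F_{\mathrm d}\phi=-\int_0^\tau\phi'(t)f(t)\,dt$. For $(x,u)\in\Gamma_\tau$, the synthesis operator triple $(X_{\mathrm d},X,U)$ associated with $(x,u)$ consists of the differentiated synthesis operator $X_{\mathrm d}$ associated with $x$, the synthesis operator $X$ associated with $x$, and the synthesis operator $U$ associated with $u$. For $\mathfrak{D}=(x,u)\in\Gamma_\tau$, $\Sigma_{\mathfrak{D}}=\{(A,B)\in\Sigma_{n,m}: x'=Ax+Bu \text{ a.e. on }[0,\tau]\}$. *)

theory Defs
  imports "HOL-Analysis.Analysis"
begin

text \<open>
  A function on \<open>[0,\<tau>]\<close> is represented by a total function on \<^typ>\<open>real\<close> of which only the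
  values on \<open>{0..\<tau>}\<close> matter. A class in \<open>L\<^sup>2\<close> is represented by any of its members, since
  everything below is invariant under modification of these on a null set.
\<close>

definition L2_on :: "real \<Rightarrow> (real \<Rightarrow> 'a::euclidean_space) set" where
  "L2_on \<tau> = {f \<in> borel_measurable (lebesgue_on {0..\<tau>}).
     integrable (lebesgue_on {0..\<tau>}) (\<lambda>t. (norm (f t))\<^sup>2)}"

text \<open>
  The usual \<open>\<epsilon>\<close>-\<open>\<delta>\<close> definition: \<^term>\<open>\<D> division_of \<Union>\<D>\<close> says that \<open>\<D>\<close> is a finite family of
  nonempty compact intervals \<open>K = {Inf K..Sup K}\<close> with pairwise disjoint interiors.
\<close>

definition abs_continuous_on :: "real set \<Rightarrow> (real \<Rightarrow> 'a::euclidean_space) \<Rightarrow> bool" where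
  "abs_continuous_on S f \<longleftrightarrow>
     (\<forall>\<epsilon>>0. \<exists>\<delta>>0. \<forall>\<D>. \<D> division_of \<Union>\<D> \<and> \<Union>\<D> \<subseteq> S \<and> (\<Sum>K\<in>\<D>. Sup K - Inf K) < \<delta>
        \<longrightarrow> (\<Sum>K\<in>\<D>. norm (f (Sup K) - f (Inf K))) < \<epsilon>)"

text \<open>The derivative is one-sided at \<open>0\<close> and \<open>\<tau>\<close>, and arbitrary where it does not exist.\<close>

definition deriv_on :: "real \<Rightarrow> (real \<Rightarrow> 'a::euclidean_space) \<Rightarrow> real \<Rightarrow> 'a" where
  "deriv_on \<tau> \<phi> t = vector_derivative \<phi> (at t within {0..\<tau>})"

text \<open>
  By Lebesgue's theorem the second conjunct follows from the first. It is listed because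
  \<^term>\<open>deriv_on \<tau> \<phi>\<close> is total, so that membership in \<open>L\<^sup>2\<close> does not by itself express that the
  derivative exists almost everywhere.
\<close>

definition H1_on :: "real \<Rightarrow> (real \<Rightarrow> 'a::euclidean_space) set" where
  "H1_on \<tau> = {\<phi>. abs_continuous_on {0..\<tau>} \<phi> \<and>
     (AE t in lebesgue_on {0..\<tau>}. \<phi> differentiable (at t within {0..\<tau>})) \<and>
     deriv_on \<tau> \<phi> \<in> L2_on \<tau>}"

definition H10_on :: "real \<Rightarrow> (real \<Rightarrow> real) set" where
  "H10_on \<tau> = {\<phi> \<in> H1_on \<tau>. \<phi> 0 = 0 \<and> \<phi> \<tau> = 0}"

definition data_set :: "real \<Rightarrow> ((real \<Rightarrow> real ^ 'n) \<times> (real \<Rightarrow> real ^ 'm)) set" where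
  "data_set \<tau> = H1_on \<tau> \<times> L2_on \<tau>"

definition synthesis :: "real \<Rightarrow> (real \<Rightarrow> real ^ 'k) \<Rightarrow> (real \<Rightarrow> real) \<Rightarrow> real ^ 'k" where
  "synthesis \<tau> f \<phi> = (LINT t|lebesgue_on {0..\<tau>}. \<phi> t *\<^sub>R f t)"

definition diff_synthesis :: "real \<Rightarrow> (real \<Rightarrow> real ^ 'k) \<Rightarrow> (real \<Rightarrow> real) \<Rightarrow> real ^ 'k" where
  "diff_synthesis \<tau> f \<phi> = - (LINT t|lebesgue_on {0..\<tau>}. deriv_on \<tau> \<phi> t *\<^sub>R f t)"

definition synthesis_triple ::
  "real \<Rightarrow> (real \<Rightarrow> real ^ 'n) \<times> (real \<Rightarrow> real ^ 'm) \<Rightarrow>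
   ((real \<Rightarrow> real) \<Rightarrow> real ^ 'n) \<times> ((real \<Rightarrow> real) \<Rightarrow> real ^ 'n) \<times> ((real \<Rightarrow> real) \<Rightarrow> real ^ 'm)" where
  "synthesis_triple \<tau> = (\<lambda>(x, u). (diff_synthesis \<tau> x, synthesis \<tau> x, synthesis \<tau> u))"

definition systems_of_data ::
  "real \<Rightarrow> (real \<Rightarrow> real ^ 'n) \<times> (real \<Rightarrow> real ^ 'm) \<Rightarrow> ((real ^ 'n ^ 'n) \<times> (real ^ 'm ^ 'n)) set" where
  "systems_of_data \<tau> = (\<lambda>(x, u). {(A, B).
     AE t in lebesgue_on {0..\<tau>}. deriv_on \<tau> x t = A *v x t + B *v u t})"

end

theory Submission
  imports Defs
begin

text \<open>
  Let \<open>r = x' - A x - B u\<close> be the residual of the system equation. The triple satisfies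
  \<open>Xd \<phi> - (A X \<phi> + B U \<phi>) = \<integral> \<phi> r\<close> for every test function \<open>\<phi>\<close>: the terms in \<open>A\<close> and \<open>B\<close> come from
  linearity, and \<open>Xd \<phi> = - \<integral> \<phi>' x = \<integral> \<phi> x'\<close> is integration by parts
  (\<open>diff_synthesis_eq_synthesis_deriv_on\<close>). So the operator identity says that \<open>r\<close> is orthogonal to
  all test functions, and the theorem says that this happens only if \<open>r = 0\<close> almost everywhere
  (\<open>AE_eq_0_if_synthesis_eq_0\<close>).

  Integration by parts rests on the fundamental theorem of calculus for absolutely continuous functions
  (\<open>fundamental_theorem_of_calculus_abs_continuous\<close>), applied to the product \<open>\<phi> x\<close>. It is derived
  directly from the definition of the gauge integral.

  For the vanishing of \<open>r\<close>, test functions of the form \<open>t (\<tau> - t) p(t)\<close> with \<open>p\<close> a polynomial are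
  enough: an integrable function orthogonal to all polynomials is zero almost everywhere, since its sign
  is a bounded almost everywhere limit of polynomials
  (\<open>AE_eq_0_if_orthogonal_to_polynomials_real\<close>).
\<close>

section \<open>Absolutely continuous functions on a compact interval\<close>

text \<open>
  The endpoints \<open>Inf K\<close> and \<open>Sup K\<close> used in the definition of absolute continuity are
  meaningful because the members of a division are nonempty and compact.
\<close>
lemma division_of_real_interval:
  fixes \<D> :: "real set set"
  assumes "\<D> division_of S" "K \<in> \<D>"
  shows "K = {Inf K..Sup K}" "Inf K \<le> Sup K" "Inf K \<in> S" "Sup K \<in> S"
proof -
  obtain u v where K: "K = {u..v}" and ne: "K \<noteq> {}"
    using division_ofD(3,4)[OF assms] by (metis box_real(2))
  moreover have "K \<subseteq> S"
    using division_ofD(2)[OF assms] .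
  ultimately show "K = {Inf K..Sup K}" "Inf K \<le> Sup K" "Inf K \<in> S" "Sup K \<in> S"
    by auto
qed

lemma abs_continuous_on_imp_continuous_on:
  assumes f: "abs_continuous_on {a..b} f"
  shows "continuous_on {a..b} f"
  unfolding continuous_on_iff
proof (intro ballI allI impI)
  fix x \<epsilon> :: real
  assume x: "x \<in> {a..b}" and "\<epsilon> > 0"
  obtain \<delta> where "\<delta> > 0" and \<delta>:
    "\<forall>\<D>. \<D> division_of \<Union>\<D> \<and> \<Union>\<D> \<subseteq> {a..b} \<and> (\<Sum>K\<in>\<D>. Sup K - Inf K) < \<delta>
       \<longrightarrow> (\<Sum>K\<in>\<D>. norm (f (Sup K) - f (Inf K))) < \<epsilon>"
    using f \<open>\<epsilon> > 0\<close> unfolding abs_continuous_on_def by blast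
  have *: "norm (f v - f u) < \<epsilon>" if "u \<in> {a..b}" "v \<in> {a..b}" "u \<le> v" "v - u < \<delta>" for u v
  proof -
    have "{{u..v}} division_of \<Union>{{u..v}}"
      using that division_of_self[of u v] by simp
    with \<delta>[rule_format, of "{{u..v}}"] that show ?thesis by simp
  qed
  show "\<exists>d>0. \<forall>x'\<in>{a..b}. dist x' x < d \<longrightarrow> dist (f x') (f x) < \<epsilon>"
  proof (intro exI[of _ \<delta>] conjI ballI impI \<open>\<delta> > 0\<close>)
    fix y assume "y \<in> {a..b}" "dist y x < \<delta>"
    then show "dist (f y) (f x) < \<epsilon>"
      using *[of x y] *[of y x] x
      by (cases "x \<le> y") (auto simp: dist_norm norm_minus_commute)
  qed
qed

text \<open>
  Both factors are bounded on the compact interval, and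
  \<open>f v *\<^sub>R g v - f u *\<^sub>R g u = (f v - f u) *\<^sub>R g v + f u *\<^sub>R (g v - g u)\<close>,
  so the variation of the product over small intervals is controlled by those of the factors.
\<close>
lemma abs_continuous_on_scaleR:
  fixes f :: "real \<Rightarrow> real" and g :: "real \<Rightarrow> 'a::euclidean_space"
  assumes f: "abs_continuous_on {a..b} f" and g: "abs_continuous_on {a..b} g"
  shows "abs_continuous_on {a..b} (\<lambda>t. f t *\<^sub>R g t)"
proof -
  have bf: "bounded (f ` {a..b})" and bg: "bounded (g ` {a..b})"
    using f g by (auto intro!: compact_imp_bounded compact_continuous_image
        abs_continuous_on_imp_continuous_on)
  obtain M1 where M1: "M1 > 0" "\<And>t. t \<in> {a..b} \<Longrightarrow> \<bar>f t\<bar> \<le> M1"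
    using bf unfolding bounded_pos by (metis image_eqI real_norm_def)
  obtain M2 where M2: "M2 > 0" "\<And>t. t \<in> {a..b} \<Longrightarrow> norm (g t) \<le> M2"
    using bg unfolding bounded_pos by (metis image_eqI)
  note M = M1(2) M2(2) and Mpos = M1(1) M2(1)
  show ?thesis
    unfolding abs_continuous_on_def
  proof (intro allI impI)
    fix \<epsilon> :: real
    assume "\<epsilon> > 0"
    define \<epsilon>1 where "\<epsilon>1 = \<epsilon> / (2 * M2)"
    define \<epsilon>2 where "\<epsilon>2 = \<epsilon> / (2 * M1)"
    have pos: "\<epsilon>1 > 0" "\<epsilon>2 > 0" and eps: "M2 * \<epsilon>1 + M1 * \<epsilon>2 = \<epsilon>"
      using Mpos \<open>\<epsilon> > 0\<close> by (auto simp: \<epsilon>1_def \<epsilon>2_def)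
    obtain \<delta>1 where "\<delta>1 > 0" and \<delta>1:
      "\<forall>\<D>. \<D> division_of \<Union>\<D> \<and> \<Union>\<D> \<subseteq> {a..b} \<and> (\<Sum>K\<in>\<D>. Sup K - Inf K) < \<delta>1
         \<longrightarrow> (\<Sum>K\<in>\<D>. norm (f (Sup K) - f (Inf K))) < \<epsilon>1"
      using f pos(1) unfolding abs_continuous_on_def by blast
    obtain \<delta>2 where "\<delta>2 > 0" and \<delta>2:
      "\<forall>\<D>. \<D> division_of \<Union>\<D> \<and> \<Union>\<D> \<subseteq> {a..b} \<and> (\<Sum>K\<in>\<D>. Sup K - Inf K) < \<delta>2
         \<longrightarrow> (\<Sum>K\<in>\<D>. norm (g (Sup K) - g (Inf K))) < \<epsilon>2"
      using g pos(2) unfolding abs_continuous_on_def by blast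
    show "\<exists>\<delta>>0. \<forall>\<D>. \<D> division_of \<Union>\<D> \<and> \<Union>\<D> \<subseteq> {a..b} \<and> (\<Sum>K\<in>\<D>. Sup K - Inf K) < \<delta> \<longrightarrow>
        (\<Sum>K\<in>\<D>. norm (f (Sup K) *\<^sub>R g (Sup K) - f (Inf K) *\<^sub>R g (Inf K))) < \<epsilon>"
    proof (intro exI[of _ "min \<delta>1 \<delta>2"] conjI allI impI, goal_cases)
      case 1
      show ?case using \<open>\<delta>1 > 0\<close> \<open>\<delta>2 > 0\<close> by simp
    next
      case (2 \<D>)
      then have D: "\<D> division_of \<Union>\<D>" "\<Union>\<D> \<subseteq> {a..b}" by auto
      have "(\<Sum>K\<in>\<D>. norm (f (Sup K) *\<^sub>R g (Sup K) - f (Inf K) *\<^sub>R g (Inf K)))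
          \<le> (\<Sum>K\<in>\<D>. M2 * norm (f (Sup K) - f (Inf K)) + M1 * norm (g (Sup K) - g (Inf K)))"
      proof (rule sum_mono)
        fix K assume "K \<in> \<D>"
        then have K: "Inf K \<in> {a..b}" "Sup K \<in> {a..b}"
          using division_of_real_interval(3,4)[OF D(1)] D(2) by blast+
        have "f (Sup K) *\<^sub>R g (Sup K) - f (Inf K) *\<^sub>R g (Inf K) =
            (f (Sup K) - f (Inf K)) *\<^sub>R g (Sup K) + f (Inf K) *\<^sub>R (g (Sup K) - g (Inf K))"
          by (simp add: algebra_simps)
        also have "norm \<dots> \<le> \<bar>f (Sup K) - f (Inf K)\<bar> * norm (g (Sup K))
            + \<bar>f (Inf K)\<bar> * norm (g (Sup K) - g (Inf K))"
          by (metis norm_triangle_ineq norm_scaleR)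
        also have "\<dots> \<le> \<bar>f (Sup K) - f (Inf K)\<bar> * M2 + M1 * norm (g (Sup K) - g (Inf K))"
          using M K by (intro add_mono mult_left_mono mult_right_mono) auto
        finally show "norm (f (Sup K) *\<^sub>R g (Sup K) - f (Inf K) *\<^sub>R g (Inf K))
            \<le> M2 * norm (f (Sup K) - f (Inf K)) + M1 * norm (g (Sup K) - g (Inf K))"
          by (simp add: mult.commute)
      qed
      also have "\<dots> = M2 * (\<Sum>K\<in>\<D>. norm (f (Sup K) - f (Inf K)))
          + M1 * (\<Sum>K\<in>\<D>. norm (g (Sup K) - g (Inf K)))"
        by (simp add: sum.distrib sum_distrib_left)
      also have "\<dots> < M2 * \<epsilon>1 + M1 * \<epsilon>2"
        using \<delta>1[rule_format, of \<D>] \<delta>2[rule_format, of \<D>] D 2 Mpos by (intro add_strict_mono mult_strict_left_mono) auto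
      finally show ?case using eps by simp
    qed
  qed
qed

lemma lipschitz_on_imp_abs_continuous_on:
  assumes "L-lipschitz_on S f"
  shows "abs_continuous_on S f"
  unfolding abs_continuous_on_def
proof (intro allI impI)
  fix \<epsilon> :: real
  assume "\<epsilon> > 0"
  have "L \<ge> 0"
    using assms by (rule lipschitz_on_nonneg)
  show "\<exists>\<delta>>0. \<forall>\<D>. \<D> division_of \<Union>\<D> \<and> \<Union>\<D> \<subseteq> S \<and> (\<Sum>K\<in>\<D>. Sup K - Inf K) < \<delta> \<longrightarrow>
      (\<Sum>K\<in>\<D>. norm (f (Sup K) - f (Inf K))) < \<epsilon>"
  proof (intro exI[of _ "\<epsilon> / (L + 1)"] conjI allI impI, goal_cases)
    case 1
    show ?case using \<open>\<epsilon> > 0\<close> \<open>L \<ge> 0\<close> by simp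
  next
    case (2 \<D>)
    then have D: "\<D> division_of \<Union>\<D>" "\<Union>\<D> \<subseteq> S" by auto
    have "(\<Sum>K\<in>\<D>. norm (f (Sup K) - f (Inf K))) \<le> (\<Sum>K\<in>\<D>. (L + 1) * (Sup K - Inf K))"
    proof (rule sum_mono)
      fix K assume "K \<in> \<D>"
      note K = division_of_real_interval[OF D(1) this]
      have "norm (f (Sup K) - f (Inf K)) \<le> L * (Sup K - Inf K)"
        using lipschitz_onD[OF assms, of "Sup K" "Inf K"] K D(2) by (auto simp: dist_norm)
      also have "\<dots> \<le> (L + 1) * (Sup K - Inf K)"
        using K(2) by (intro mult_right_mono) auto
      finally show "norm (f (Sup K) - f (Inf K)) \<le> (L + 1) * (Sup K - Inf K)" .
    qed
    also have "\<dots> = (L + 1) * (\<Sum>K\<in>\<D>. Sup K - Inf K)"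
      by (simp add: sum_distrib_left)
    also have "\<dots> < \<epsilon>"
      using 2 \<open>L \<ge> 0\<close> by (simp add: field_simps)
    finally show ?case .
  qed
qed

text \<open>
  The gauge integral allows a proof with no differentiation of measures. Let \<open>N\<close> be the null set
  where the derivative fails, and replace \<open>f'\<close> by \<open>0\<close> there. For a sufficiently fine tagged division,
  an interval with tag outside \<open>N\<close> contributes to the error at most \<open>e\<close> times its length, by
  differentiability at the tag. The intervals with tag in \<open>N\<close> lie in an open set of small measure
  around \<open>N\<close>; absolute continuity bounds the total increment of \<open>f\<close> over them.
\<close>
lemma fundamental_theorem_of_calculus_abs_continuous:
  fixes f :: "real \<Rightarrow> 'a::euclidean_space"
  assumes "a \<le> b" and f: "abs_continuous_on {a..b} f"
    and ae: "AE t in lebesgue_on {a..b}. (f has_vector_derivative f' t) (at t within {a..b})"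
  shows "(f' has_integral (f b - f a)) {a..b}"
proof -
  define N where "N = {t \<in> {a..b}. \<not> (f has_vector_derivative f' t) (at t within {a..b})}"
  define h where "h = (\<lambda>t. if t \<in> N then 0 else f' t)"
  have "AE t in lebesgue. t \<in> {a..b} \<longrightarrow> (f has_vector_derivative f' t) (at t within {a..b})"
    using ae by (simp add: AE_restrict_space_iff)
  then have N0: "N \<in> null_sets lebesgue"
    by (simp add: completion.AE_iff_null_sets N_def)
  then have negN: "negligible N"
    by (simp add: negligible_iff_null_sets)
  have "(h has_integral (f b - f a)) {a..b}"
    unfolding has_integral_real
  proof (intro allI impI)
    fix \<epsilon> :: real
    assume "\<epsilon> > 0"
    \<comment> \<open>Tags outside \<open>N\<close> and tags in \<open>N\<close> each account for \<open>\<epsilon> / 2\<close>; the summand \<open>1\<close> covers \<open>a = b\<close>.\<close>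
    define e where "e = \<epsilon> / (2 * (b - a + 1))"
    have "e > 0" and e_le: "e * (b - a) \<le> \<epsilon> / 2"
      using \<open>\<epsilon> > 0\<close> \<open>a \<le> b\<close> by (auto simp: e_def field_simps)
    obtain \<delta> where "\<delta> > 0" and \<delta>:
      "\<forall>\<D>. \<D> division_of \<Union>\<D> \<and> \<Union>\<D> \<subseteq> {a..b} \<and> (\<Sum>K\<in>\<D>. Sup K - Inf K) < \<delta>
         \<longrightarrow> (\<Sum>K\<in>\<D>. norm (f (Sup K) - f (Inf K))) < \<epsilon> / 2"
      using f half_gt_zero[OF \<open>\<epsilon> > 0\<close>] unfolding abs_continuous_on_def by blast
    obtain T where "open T" "N \<subseteq> T" and T: "T - N \<in> lmeasurable" "emeasure lebesgue (T - N) < ennreal \<delta>"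
      using sets_lebesgue_outer_open[OF null_setsD2[OF N0] \<open>\<delta> > 0\<close>] by metis
    have Tm: "T \<in> lmeasurable" "measure lebesgue T < \<delta>"
    proof -
      have em: "emeasure lebesgue T = emeasure lebesgue (T - N)"
        using emeasure_Diff_null_set[OF N0, of T] \<open>open T\<close> by simp
      with T(2) \<open>open T\<close> show "T \<in> lmeasurable"
        by (auto simp: fmeasurable_def intro: order.strict_trans)
      then show "measure lebesgue T < \<delta>"
        using em T(2) by (metis emeasure_eq_measure2 ennreal_less_iff measure_nonneg)
    qed
    have "\<forall>t. \<exists>d>0. t \<in> {a..b} - N \<longrightarrow>
        (\<forall>s\<in>{a..b}. norm (s - t) < d \<longrightarrow> norm (f s - f t - (s - t) *\<^sub>R f' t) \<le> e * norm (s - t))"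
    proof
      fix t
      show "\<exists>d>0. t \<in> {a..b} - N \<longrightarrow>
        (\<forall>s\<in>{a..b}. norm (s - t) < d \<longrightarrow> norm (f s - f t - (s - t) *\<^sub>R f' t) \<le> e * norm (s - t))"
      proof (cases "t \<in> {a..b} - N")
        case True
        then have "(f has_vector_derivative f' t) (at t within {a..b})"
          by (auto simp: N_def)
        then show ?thesis
          using \<open>e > 0\<close> unfolding has_vector_derivative_def has_derivative_within_alt by blast
      qed (auto intro: exI[of _ 1])
    qed
    then obtain d where d: "\<And>t. 0 < d t"
      "\<And>s t. \<lbrakk>t \<in> {a..b}; t \<notin> N; s \<in> {a..b}; norm (s - t) < d t\<rbrakk>
          \<Longrightarrow> norm (f s - f t - (s - t) *\<^sub>R f' t) \<le> e * norm (s - t)"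
      by (metis DiffI)
    define \<gamma> where "\<gamma> = (\<lambda>t. if t \<in> N then T else ball t (d t))"
    show "\<exists>\<gamma>. gauge \<gamma> \<and> (\<forall>p. p tagged_division_of {a..b} \<and> \<gamma> fine p \<longrightarrow>
        norm ((\<Sum>(t, K)\<in>p. measure lborel K *\<^sub>R h t) - (f b - f a)) < \<epsilon>)"
    proof (intro exI[of _ \<gamma>] conjI allI impI)
      show "gauge \<gamma>"
        using \<open>open T\<close> \<open>N \<subseteq> T\<close> d(1) by (auto simp: gauge_def \<gamma>_def)
    next
      fix p assume "p tagged_division_of {a..b} \<and> \<gamma> fine p"
      then have p: "p tagged_division_of {a..b}" and fine: "\<gamma> fine p" by auto
      have K: "K = {Inf K..Sup K}" "Inf K \<le> t" "t \<le> Sup K" "Inf K \<in> {a..b}" "Sup K \<in> {a..b}"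
        "t \<in> {a..b}" "Inf K \<in> \<gamma> t" "Sup K \<in> \<gamma> t" if tK: "(t, K) \<in> p" for t K
      proof -
        obtain u v where uv: "K = {u..v}"
          using tagged_division_ofD(4)[OF p tK] by (metis box_real(2))
        moreover have "t \<in> K" "K \<subseteq> {a..b}" "K \<subseteq> \<gamma> t"
          using tagged_division_ofD(2,3)[OF p tK] fineD[OF fine tK] by auto
        ultimately show "K = {Inf K..Sup K}" "Inf K \<le> t" "t \<le> Sup K" "Inf K \<in> {a..b}" "Sup K \<in> {a..b}"
          "t \<in> {a..b}" "Inf K \<in> \<gamma> t" "Sup K \<in> \<gamma> t"
          by auto
      qed
      have len: "measure lborel K = Sup K - Inf K" if "(t, K) \<in> p" for t K
        using K(2,3)[OF that] by (subst K(1)[OF that]) simp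
      have finp: "finite p" using p by blast
      define q where "q = {(t, K) \<in> p. t \<in> N}"
      have qp: "q \<subseteq> p" by (auto simp: q_def)
      have "q tagged_partial_division_of {a..b}"
        using tagged_partial_division_subset[OF _ qp] p by (auto simp: tagged_division_of_def)
      then have q: "q tagged_division_of \<Union>(snd ` q)"
        using tagged_partial_division_of_Union_self by blast
      note D = division_of_tagged_division[OF q]
      have small: "(\<Sum>(t, K)\<in>q. norm (f (Sup K) - f (Inf K))) < \<epsilon> / 2"
      proof -
        have sub: "\<Union>(snd ` q) \<subseteq> {a..b}"
          using tagged_division_ofD(3)[OF p] qp by fastforce
        have "K \<subseteq> T" if "(t, K) \<in> q" for t K
          using that fineD[OF fine, of t K] by (auto simp: q_def \<gamma>_def)
        then have subT: "\<Union>(snd ` q) \<subseteq> T" by fastforce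
        have "(\<Sum>K\<in>snd ` q. Sup K - Inf K) = (\<Sum>K\<in>snd ` q. measure lebesgue K)"
        proof (rule sum.cong[OF refl])
          fix K assume "K \<in> snd ` q"
          then obtain t where "(t, K) \<in> p" using qp by auto
          note K = K(1)[OF this] and len = len[OF this]
          have "K \<in> sets lborel"
            by (subst K) simp
          then show "Sup K - Inf K = measure lebesgue K"
            by (simp add: len)
        qed
        also have "\<dots> = measure lebesgue (\<Union>(snd ` q))"
          by (rule content_division[OF D])
        also have "\<dots> \<le> measure lebesgue T"
          using subT Tm(1) lmeasurable_division[OF D] by (intro measure_mono_fmeasurable) (auto simp: fmeasurableD)
        finally have "(\<Sum>K\<in>snd ` q. Sup K - Inf K) < \<delta>"
          using Tm(2) by simp
        with \<delta> sub D have "(\<Sum>K\<in>snd ` q. norm (f (Sup K) - f (Inf K))) < \<epsilon> / 2" by blast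
        moreover have "(\<Sum>(t, K)\<in>q. norm (f (Sup K) - f (Inf K))) = (\<Sum>K\<in>snd ` q. norm (f (Sup K) - f (Inf K)))"
        \<comment> \<open>Distinct tags may carry the same interval only if it is degenerate. The summand then
            vanishes, but \<open>Sup {}\<close> and \<open>Inf {}\<close> are unspecified, hence the case distinction.\<close>
        proof -
          define \<Delta> where "\<Delta> K = (if K = {} then 0 else norm (f (Sup K) - f (Inf K)))" for K
          have \<Delta>: "norm (f (Sup K) - f (Inf K)) = \<Delta> K" if "(t, K) \<in> q" for t K
            using tagged_division_ofD(2)[OF q that] by (auto simp: \<Delta>_def)
          have "(\<Sum>(t, K)\<in>q. norm (f (Sup K) - f (Inf K))) = (\<Sum>(t, K)\<in>q. \<Delta> K)"
            using \<Delta> by (intro sum.cong) auto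
          also have "\<dots> = (\<Sum>K\<in>snd ` q. \<Delta> K)"
            by (rule sum.over_tagged_division_lemma[OF q]) (auto simp: \<Delta>_def le_less)
          also have "\<dots> = (\<Sum>K\<in>snd ` q. norm (f (Sup K) - f (Inf K)))"
            using \<Delta> by (intro sum.cong) auto
          finally show ?thesis .
        qed
        ultimately show ?thesis by simp
      qed
      have ba: "b - a = (\<Sum>(t, K)\<in>p. Sup K - Inf K)" "f b - f a = (\<Sum>(t, K)\<in>p. f (Sup K) - f (Inf K))"
        using additive_tagged_division_1[where f = "\<lambda>x. x"] additive_tagged_division_1[where f = f]
          \<open>a \<le> b\<close> p by auto
      have "norm ((\<Sum>(t, K)\<in>p. measure lborel K *\<^sub>R h t) - (f b - f a))
          = norm (\<Sum>(t, K)\<in>p. measure lborel K *\<^sub>R h t - (f (Sup K) - f (Inf K)))"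
        by (simp add: ba(2) sum_subtractf split_def)
      also have "\<dots> \<le> (\<Sum>(t, K)\<in>p. (if t \<in> N then norm (f (Sup K) - f (Inf K)) else 0) + e * (Sup K - Inf K))"
      proof (rule sum_norm_le, safe)
        fix t K assume tK: "(t, K) \<in> p"
        note K = K[OF tK]
        note len = len[OF tK]
        show "norm (measure lborel K *\<^sub>R h t - (f (Sup K) - f (Inf K)))
            \<le> (if t \<in> N then norm (f (Sup K) - f (Inf K)) else 0) + e * (Sup K - Inf K)"
        proof (cases "t \<in> N")
          case True
          then show ?thesis using K(2,3) \<open>e > 0\<close> by (simp add: h_def norm_minus_commute)
        next
          case False
          then have near: "norm (Inf K - t) < d t" "norm (Sup K - t) < d t"
            using K(7,8) by (auto simp: \<gamma>_def dist_real_def)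
          have "measure lborel K *\<^sub>R h t - (f (Sup K) - f (Inf K))
              = (f (Inf K) - f t - (Inf K - t) *\<^sub>R f' t) - (f (Sup K) - f t - (Sup K - t) *\<^sub>R f' t)"
            using False by (simp add: len h_def algebra_simps)
          also have "norm \<dots> \<le> e * norm (Inf K - t) + e * norm (Sup K - t)"
            by (rule order_trans[OF norm_triangle_ineq4 add_mono[OF
                  d(2)[OF K(6) False K(4) near(1)] d(2)[OF K(6) False K(5) near(2)]]])
          also have "\<dots> = e * (Sup K - Inf K)"
            using K(2,3) by (simp add: algebra_simps)
          finally show ?thesis using False by simp
        qed
      qed
      also have "\<dots> = (\<Sum>(t, K)\<in>q. norm (f (Sup K) - f (Inf K))) + e * (b - a)"
        unfolding ba(1) q_def
        by (simp add: split_def sum.distrib sum_distrib_left sum.inter_filter[OF finp])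
      also have "\<dots> < \<epsilon>"
        using small e_le by simp
      finally show "norm ((\<Sum>(t, K)\<in>p. measure lborel K *\<^sub>R h t) - (f b - f a)) < \<epsilon>" .
    qed
  qed
  then show ?thesis
    by (rule has_integral_spike[OF negN, rotated]) (auto simp: h_def)
qed

section \<open>The function spaces\<close>

lemma deriv_on_eq:
  fixes f :: "real \<Rightarrow> 'a::euclidean_space"
  assumes "\<tau> > 0" "t \<in> {0..\<tau>}" "(f has_vector_derivative f') (at t within {0..\<tau>})"
  shows "deriv_on \<tau> f t = f'"
  unfolding deriv_on_def using assms by (rule vector_derivative_within_closed_interval)

lemma continuously_differentiable_imp_H1_on:
  fixes f :: "real \<Rightarrow> 'a::euclidean_space"
  assumes "\<tau> > 0"
    and deriv: "\<And>t. t \<in> {0..\<tau>} \<Longrightarrow> (f has_vector_derivative f' t) (at t within {0..\<tau>})"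
    and cont: "continuous_on {0..\<tau>} f'"
  shows "f \<in> H1_on \<tau>"
proof -
  have eq: "deriv_on \<tau> f t = f' t" if "t \<in> {0..\<tau>}" for t
    using deriv_on_eq[OF \<open>\<tau> > 0\<close> that deriv[OF that]] .
  have "bounded (f' ` {0..\<tau>})"
    by (intro compact_imp_bounded compact_continuous_image cont) auto
  then obtain L where L: "L > 0" "\<And>t. t \<in> {0..\<tau>} \<Longrightarrow> norm (f' t) \<le> L"
    unfolding bounded_pos by (metis image_eqI)
  have "L-lipschitz_on {0..\<tau>} f"
  proof (rule bounded_derivative_imp_lipschitz)
    show "(f has_derivative (\<lambda>h. h *\<^sub>R f' t)) (at t within {0..\<tau>})" if "t \<in> {0..\<tau>}" for t
      using deriv[OF that] by (simp add: has_vector_derivative_def)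
    show "onorm (\<lambda>h. h *\<^sub>R f' t) \<le> L" if "t \<in> {0..\<tau>}" for t
      using L(2)[OF that] by (intro onorm_le) (metis abs_ge_zero mult.commute mult_left_mono norm_scaleR real_norm_def)
  qed (use L in auto)
  then have "abs_continuous_on {0..\<tau>} f"
    by (rule lipschitz_on_imp_abs_continuous_on)
  moreover have "AE t in lebesgue_on {0..\<tau>}. f differentiable (at t within {0..\<tau>})"
    using deriv by (intro AE_I2) (auto intro: differentiableI_vector)
  moreover have "deriv_on \<tau> f \<in> L2_on \<tau>"
  proof -
    have "f' \<in> borel_measurable (lebesgue_on {0..\<tau>})"
      using cont by (intro continuous_imp_measurable_on_sets_lebesgue) auto
    moreover have "integrable (lebesgue_on {0..\<tau>}) (\<lambda>t. (norm (f' t))\<^sup>2)"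
      by (intro continuous_imp_integrable_real continuous_intros cont)
    ultimately show ?thesis
      using measurable_cong[of "lebesgue_on {0..\<tau>}" "deriv_on \<tau> f" f' borel]
        Bochner_Integration.integrable_cong[of "lebesgue_on {0..\<tau>}" "lebesgue_on {0..\<tau>}"
          "\<lambda>t. (norm (deriv_on \<tau> f t))\<^sup>2" "\<lambda>t. (norm (f' t))\<^sup>2"]
      by (simp add: L2_on_def eq)
  qed
  ultimately show ?thesis
    by (simp add: H1_on_def)
qed

text \<open>The interval has finite measure, and \<open>norm v \<le> 1 + (norm v)\<^sup>2\<close>.\<close>
lemma L2_on_imp_integrable:
  fixes f :: "real \<Rightarrow> 'a::euclidean_space"
  assumes "f \<in> L2_on \<tau>"
  shows "integrable (lebesgue_on {0..\<tau>}) f"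
proof (rule Bochner_Integration.integrable_bound)
  show "integrable (lebesgue_on {0..\<tau>}) (\<lambda>t. 1 + (norm (f t))\<^sup>2)"
    using assms continuous_imp_integrable_real[of 0 \<tau> "\<lambda>_. 1 :: real"]
    by (intro Bochner_Integration.integrable_add) (auto simp: L2_on_def)
  show "f \<in> borel_measurable (lebesgue_on {0..\<tau>})"
    using assms by (simp add: L2_on_def)
  have "norm v \<le> 1 + (norm v)\<^sup>2" for v :: 'a
  proof -
    have "0 \<le> (norm v - 1)\<^sup>2 + norm v" by simp
    then show ?thesis by (simp add: power2_diff)
  qed
  then show "AE t in lebesgue_on {0..\<tau>}. norm (f t) \<le> norm (1 + (norm (f t))\<^sup>2)"
    by simp
qed

lemma H1_onD:
  assumes "f \<in> H1_on \<tau>"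
  shows "abs_continuous_on {0..\<tau>} f" "continuous_on {0..\<tau>} f"
    "AE t in lebesgue_on {0..\<tau>}. (f has_vector_derivative deriv_on \<tau> f t) (at t within {0..\<tau>})"
    "integrable (lebesgue_on {0..\<tau>}) (deriv_on \<tau> f)"
  using assms unfolding H1_on_def deriv_on_def
  by (auto simp: vector_derivative_works abs_continuous_on_imp_continuous_on
      dest: L2_on_imp_integrable)

lemma integrable_continuous_scaleR:
  fixes \<phi> :: "real \<Rightarrow> real" and f :: "real \<Rightarrow> 'a::euclidean_space"
  assumes \<phi>: "continuous_on {a..b} \<phi>" and f: "integrable (lebesgue_on {a..b}) f"
  shows "integrable (lebesgue_on {a..b}) (\<lambda>t. \<phi> t *\<^sub>R f t)"
proof -
  have "bounded (\<phi> ` {a..b})"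
    by (intro compact_imp_bounded compact_continuous_image \<phi>) auto
  then obtain M where M: "M > 0" "\<And>t. t \<in> {a..b} \<Longrightarrow> \<bar>\<phi> t\<bar> \<le> M"
    unfolding bounded_pos by (metis image_eqI real_norm_def)
  have [measurable]: "\<phi> \<in> borel_measurable (lebesgue_on {a..b})"
    using \<phi> by (intro continuous_imp_measurable_on_sets_lebesgue) auto
  have [measurable]: "f \<in> borel_measurable (lebesgue_on {a..b})"
    using f by auto
  show ?thesis
  proof (rule Bochner_Integration.integrable_bound)
    show "integrable (lebesgue_on {a..b}) (\<lambda>t. M *\<^sub>R f t)"
      using f by simp
    show "AE t in lebesgue_on {a..b}. norm (\<phi> t *\<^sub>R f t) \<le> norm (M *\<^sub>R f t)"
      using M by (intro AE_I2) (auto intro!: mult_right_mono)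
  qed measurable
qed

section \<open>Integration by parts\<close>

text \<open>
  Integration by parts: \<open>\<phi> *\<^sub>R x\<close> is absolutely continuous and vanishes at both ends of
  the interval, so the integral of its derivative is \<open>0\<close>.
\<close>
lemma diff_synthesis_eq_synthesis_deriv_on:
  fixes x :: "real \<Rightarrow> real ^ 'n"
  assumes "\<tau> > 0" and x: "x \<in> H1_on \<tau>" and \<phi>: "\<phi> \<in> H10_on \<tau>"
  shows "diff_synthesis \<tau> x \<phi> = synthesis \<tau> (deriv_on \<tau> x) \<phi>"
proof -
  have \<phi>1: "\<phi> \<in> H1_on \<tau>" and bc: "\<phi> 0 = 0" "\<phi> \<tau> = 0"
    using \<phi> by (auto simp: H10_on_def)
  note x = H1_onD[OF x] and \<phi> = H1_onD[OF \<phi>1]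
  let ?M = "lebesgue_on {0..\<tau>}"
  have i1: "integrable ?M (\<lambda>t. \<phi> t *\<^sub>R deriv_on \<tau> x t)"
    by (rule integrable_continuous_scaleR[OF \<phi>(2) x(4)])
  \<comment> \<open>Here the continuous factor is the vector and the integrable one the scalar, so integrability is
      obtained componentwise.\<close>
  have "integrable ?M (\<lambda>t. (x t \<bullet> b) * deriv_on \<tau> \<phi> t)" for b
    using integrable_continuous_scaleR[OF _ \<phi>(4), of "\<lambda>t. x t \<bullet> b"] x(2)
    by (simp add: continuous_on_inner)
  then have "integrable ?M (\<lambda>t. \<Sum>b\<in>Basis. ((x t \<bullet> b) * deriv_on \<tau> \<phi> t) *\<^sub>R b)"
    by (intro Bochner_Integration.integrable_sum integrable_scaleR_left)
  also have "(\<lambda>t. \<Sum>b\<in>Basis. ((x t \<bullet> b) * deriv_on \<tau> \<phi> t) *\<^sub>R b) = (\<lambda>t. deriv_on \<tau> \<phi> t *\<^sub>R x t)"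
    by (rule ext, subst (2) euclidean_representation[symmetric])
      (simp add: scaleR_sum_right mult.commute)
  finally have i2: "integrable ?M (\<lambda>t. deriv_on \<tau> \<phi> t *\<^sub>R x t)" .
  have "((\<lambda>t. \<phi> t *\<^sub>R deriv_on \<tau> x t + deriv_on \<tau> \<phi> t *\<^sub>R x t) has_integral
      (\<phi> \<tau> *\<^sub>R x \<tau> - \<phi> 0 *\<^sub>R x 0)) {0..\<tau>}"
  proof (rule fundamental_theorem_of_calculus_abs_continuous)
    show "abs_continuous_on {0..\<tau>} (\<lambda>t. \<phi> t *\<^sub>R x t)"
      by (rule abs_continuous_on_scaleR[OF \<phi>(1) x(1)])
    show "AE t in ?M. ((\<lambda>t. \<phi> t *\<^sub>R x t) has_vector_derivative
        \<phi> t *\<^sub>R deriv_on \<tau> x t + deriv_on \<tau> \<phi> t *\<^sub>R x t) (at t within {0..\<tau>})"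
      using x(3) \<phi>(3)
      by eventually_elim
        (auto intro!: has_vector_derivative_scaleR simp: has_real_derivative_iff_has_vector_derivative)
  qed (use \<open>\<tau> > 0\<close> in simp)
  then have "(LINT t|?M. \<phi> t *\<^sub>R deriv_on \<tau> x t + deriv_on \<tau> \<phi> t *\<^sub>R x t) = 0"
    using i1 i2 bc by (subst lebesgue_integral_eq_integral) (auto simp: integral_unique)
  then show ?thesis
    using i1 i2 by (simp add: diff_synthesis_def synthesis_def eq_neg_iff_add_eq_0 add.commute neg_eq_iff_add_eq_0)
qed

section \<open>Testing against polynomials\<close>

lemma AE_lebesgue_on_notin_negligible:
  assumes "negligible N" "S \<in> sets lebesgue"
  shows "AE t in lebesgue_on S. t \<notin> N"
proof -
  have "AE t in lebesgue. t \<notin> N"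
    using assms(1) by (simp add: negligible_iff_null_sets AE_not_in)
  then show ?thesis
    using assms(2) by (subst AE_restrict_space_iff) (auto elim: eventually_mono)
qed

text \<open>
  The sign \<open>s\<close> of \<open>h\<close> is an almost everywhere limit of continuous functions. Truncating these to
  \<open>[-1, 1]\<close> and approximating each uniformly gives polynomials \<open>p\<^sub>n\<close>, bounded by \<open>2\<close> on the interval,
  with \<open>p\<^sub>n \<longlonglongrightarrow> s\<close> almost everywhere. By dominated convergence, the integral of
  \<open>\<bar>h\<bar> = s * h\<close> is the limit of the integrals of \<open>p\<^sub>n * h\<close>, all of which vanish.
\<close>
lemma AE_eq_0_if_orthogonal_to_polynomials_real:
  fixes h :: "real \<Rightarrow> real"
  assumes h: "integrable (lebesgue_on {a..b}) h"
    and orth: "\<And>p. real_polynomial_function p \<Longrightarrow> (LINT t|lebesgue_on {a..b}. p t * h t) = 0"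
  shows "AE t in lebesgue_on {a..b}. h t = 0"
proof -
  let ?M = "lebesgue_on {a..b}"
  have [measurable]: "h \<in> borel_measurable ?M"
    using h by auto
  define s :: "real \<Rightarrow> real" where "s = (\<lambda>t. if h t \<ge> 0 then 1 else -1)"
  have "s \<in> borel_measurable ?M"
    unfolding s_def by measurable
  then have "s measurable_on {a..b}"
    by (simp add: measurable_on_iff_borel_measurable)
  then obtain N g where N: "negligible N" and g: "\<And>n::nat. continuous_on UNIV (g n)"
    and g_lim: "\<And>t. t \<notin> N \<Longrightarrow> (\<lambda>n. g n t) \<longlonglongrightarrow> (if t \<in> {a..b} then s t else 0)"
    unfolding measurable_on_def by metis
  define c where "c n t = max (-1) (min 1 (g n t))" for n t
  have "\<exists>p. real_polynomial_function p \<and> (\<forall>t\<in>{a..b}. \<bar>c n t - p t\<bar> < inverse (Suc n))" for n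
  proof -
    have "continuous_on {a..b} (c n)"
      unfolding c_def by (intro continuous_intros continuous_on_subset[OF g]) auto
    then show ?thesis
      using Stone_Weierstrass_real_polynomial_function[of "{a..b}" "c n" "inverse (Suc n)"]
      by (metis compact_Icc inverse_positive_iff_positive of_nat_0_less_iff zero_less_Suc)
  qed
  then obtain p where p: "\<And>n. real_polynomial_function (p n)"
    and p_near: "\<And>n t. t \<in> {a..b} \<Longrightarrow> \<bar>c n t - p n t\<bar> < inverse (Suc n)"
    by metis
  have p_meas [measurable]: "p n \<in> borel_measurable ?M" for n
    using continuous_on_polymonial_function[of "p n" "{a..b}"] p
    by (intro continuous_imp_measurable_on_sets_lebesgue) (auto simp: real_polynomial_function_eq)
  have "(\<lambda>n. LINT t|?M. p n t * h t) \<longlonglongrightarrow> (LINT t|?M. \<bar>h t\<bar>)"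
  proof (rule integral_dominated_convergence)
    show "integrable ?M (\<lambda>t. 2 * \<bar>h t\<bar>)"
      using h by simp
    show "AE t in ?M. norm (p n t * h t) \<le> 2 * \<bar>h t\<bar>" for n
    proof (rule AE_I2)
      fix t assume "t \<in> space ?M"
      then have "t \<in> {a..b}" by simp
      moreover have "\<bar>c n t\<bar> \<le> 1"
        by (auto simp: c_def)
      moreover have "inverse (real (Suc n)) \<le> 1"
        by (simp add: field_simps)
      ultimately have "\<bar>p n t\<bar> \<le> 2"
        using p_near[of t n] by linarith
      then show "norm (p n t * h t) \<le> 2 * \<bar>h t\<bar>"
        by (simp add: abs_mult mult_right_mono)
    qed
    have "AE t in ?M. t \<notin> N"
      by (rule AE_lebesgue_on_notin_negligible[OF N]) simp
    moreover have "AE t in ?M. t \<in> {a..b}"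
      by (intro AE_I2) simp
    ultimately show "AE t in ?M. (\<lambda>n. p n t * h t) \<longlonglongrightarrow> \<bar>h t\<bar>"
    proof eventually_elim
      case (elim t)
      have "(\<lambda>n. c n t) \<longlonglongrightarrow> max (-1) (min 1 (s t))"
        unfolding c_def using g_lim[of t] elim by (intro tendsto_intros) auto
      moreover have "max (-1) (min 1 (s t)) = s t"
        by (simp add: s_def)
      moreover have "(\<lambda>n. c n t - p n t) \<longlonglongrightarrow> 0"
        using p_near[OF elim(2)] less_imp_le
        by (intro Lim_null_comparison[OF _ LIMSEQ_inverse_real_of_nat]) (auto intro!: always_eventually)
      ultimately have "(\<lambda>n. c n t - (c n t - p n t)) \<longlonglongrightarrow> s t - 0"
        by (intro tendsto_diff) auto
      then have "(\<lambda>n. p n t * h t) \<longlonglongrightarrow> s t * h t"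
        by (intro tendsto_mult_right) simp
      also have "s t * h t = \<bar>h t\<bar>"
        by (simp add: s_def)
      finally show ?case .
    qed
  qed measurable
  then have "(LINT t|?M. \<bar>h t\<bar>) = 0"
    using orth[OF p] by (simp add: LIMSEQ_const_iff)
  then show ?thesis
    using h by (subst (asm) integral_nonneg_eq_0_iff_AE) auto
qed

lemma AE_eq_0_if_orthogonal_to_polynomials:
  fixes h :: "real \<Rightarrow> 'a::euclidean_space"
  assumes h: "integrable (lebesgue_on {a..b}) h"
    and orth: "\<And>p. real_polynomial_function p \<Longrightarrow> (LINT t|lebesgue_on {a..b}. p t *\<^sub>R h t) = 0"
  shows "AE t in lebesgue_on {a..b}. h t = 0"
proof -
  let ?M = "lebesgue_on {a..b}"
  have "AE t in ?M. h t \<bullet> i = 0" for i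
  proof (rule AE_eq_0_if_orthogonal_to_polynomials_real)
    fix p :: "real \<Rightarrow> real"
    assume p: "real_polynomial_function p"
    then have "continuous_on {a..b} p"
      by (simp add: real_polynomial_function_eq continuous_on_polymonial_function)
    then have "integrable ?M (\<lambda>t. p t *\<^sub>R h t)"
      by (rule integrable_continuous_scaleR[OF _ h])
    then have "(LINT t|?M. (p t *\<^sub>R h t) \<bullet> i) = (LINT t|?M. p t *\<^sub>R h t) \<bullet> i"
      by (rule integral_inner_left)
    then show "(LINT t|?M. p t * (h t \<bullet> i)) = 0"
      using orth[OF p] by simp
  qed (use h in simp)
  then have "AE t in ?M. \<forall>i\<in>Basis. h t \<bullet> i = 0"
    by (intro AE_finite_allI) auto
  then show ?thesis
    by eventually_elim (simp add: euclidean_all_zero_iff)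
qed

text \<open>
  The factor \<open>t * (\<tau> - t)\<close> enforces the boundary conditions and has no zero inside the interval.
\<close>
lemma polynomial_in_H10_on:
  assumes "\<tau> > 0" and p: "real_polynomial_function p"
  shows "(\<lambda>t. t * (\<tau> - t) * p t) \<in> H10_on \<tau>"
proof -
  have q: "real_polynomial_function (\<lambda>t. t * (\<tau> - t) * p t)"
    by (intro real_polynomial_function.intros(4) real_polynomial_function_diff
        real_polynomial_function.intros(2) real_polynomial_function.intros(1) bounded_linear_ident p)
  obtain q' where q': "real_polynomial_function q'"
    "\<And>t. ((\<lambda>t. t * (\<tau> - t) * p t) has_real_derivative q' t) (at t)"
    using has_real_derivative_polynomial_function[OF q] by blast
  have "(\<lambda>t. t * (\<tau> - t) * p t) \<in> H1_on \<tau>"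
  proof (rule continuously_differentiable_imp_H1_on[OF \<open>\<tau> > 0\<close>])
    show "continuous_on {0..\<tau>} q'"
      using q'(1) by (simp add: real_polynomial_function_eq continuous_on_polymonial_function)
    show "((\<lambda>t. t * (\<tau> - t) * p t) has_vector_derivative q' t) (at t within {0..\<tau>})" for t
      using q'(2)[of t] has_real_derivative_iff_has_vector_derivative has_vector_derivative_at_within
      by blast
  qed
  then show ?thesis
    by (simp add: H10_on_def)
qed

text \<open>
  This is the fundamental lemma of the calculus of variations. The test functions
  \<open>t * (\<tau> - t) * p t\<close> with \<open>p\<close> a polynomial suffice: they show that \<open>t * (\<tau> - t)\<close> times \<open>r t\<close> is
  orthogonal to all polynomials, and the weight vanishes at the endpoints only.
\<close>
lemma AE_eq_0_if_synthesis_eq_0: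
  fixes r :: "real \<Rightarrow> real ^ 'n"
  assumes "\<tau> > 0" and r: "integrable (lebesgue_on {0..\<tau>}) r"
    and zero: "\<And>\<phi>. \<phi> \<in> H10_on \<tau> \<Longrightarrow> synthesis \<tau> r \<phi> = 0"
  shows "AE t in lebesgue_on {0..\<tau>}. r t = 0"
proof -
  let ?M = "lebesgue_on {0..\<tau>}"
  have "AE t in ?M. (t * (\<tau> - t)) *\<^sub>R r t = 0"
  proof (rule AE_eq_0_if_orthogonal_to_polynomials)
    show "integrable ?M (\<lambda>t. (t * (\<tau> - t)) *\<^sub>R r t)"
      by (intro integrable_continuous_scaleR r continuous_intros)
    show "(LINT t|?M. p t *\<^sub>R (t * (\<tau> - t)) *\<^sub>R r t) = 0" if "real_polynomial_function p" for p
      using zero[OF polynomial_in_H10_on[OF \<open>\<tau> > 0\<close> that]]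
      by (simp add: synthesis_def mult_ac)
  qed
  moreover have "AE t in ?M. t \<notin> {0, \<tau>}"
    by (rule AE_lebesgue_on_notin_negligible) auto
  ultimately show ?thesis
    by eventually_elim auto
qed

section \<open>Compatible systems and the operator identity\<close>

theorem lemma2p2:
  fixes \<tau> :: real
    and x :: "real \<Rightarrow> real ^ 'n" and u :: "real \<Rightarrow> real ^ 'm"
    and Xd X :: "(real \<Rightarrow> real) \<Rightarrow> real ^ 'n" and U :: "(real \<Rightarrow> real) \<Rightarrow> real ^ 'm"
  assumes "\<tau> > 0"
    and "(x, u) \<in> data_set \<tau>"
    and "(Xd, X, U) = synthesis_triple \<tau> (x, u)"
  shows "\<forall>(A :: real ^ 'n ^ 'n) (B :: real ^ 'm ^ 'n).
    (A, B) \<in> systems_of_data \<tau> (x, u) \<longleftrightarrow>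
    (\<forall>\<phi>\<in>H10_on \<tau>. Xd \<phi> = A *v X \<phi> + B *v U \<phi>)"
proof (intro allI)
  fix A :: "real ^ 'n ^ 'n" and B :: "real ^ 'm ^ 'n"
  let ?M = "lebesgue_on {0..\<tau>}"
  define r where "r t = deriv_on \<tau> x t - (A *v x t + B *v u t)" for t
  have x: "x \<in> H1_on \<tau>" and u: "integrable ?M u"
    using assms(2) by (auto simp: data_set_def intro: L2_on_imp_integrable)
  have triple: "Xd = diff_synthesis \<tau> x" "X = synthesis \<tau> x" "U = synthesis \<tau> u"
    using assms(3) by (auto simp: synthesis_triple_def)
  note x' = H1_onD(4)[OF x]
  have xi: "integrable ?M x"
    using continuous_imp_integrable_real[OF H1_onD(2)[OF x]] .
  have r: "integrable ?M r"
    unfolding r_def using x' xi u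
    by (intro Bochner_Integration.integrable_diff Bochner_Integration.integrable_add
        integrable_bounded_linear[OF matrix_vector_mul_bounded_linear])
  have synth: "synthesis \<tau> r \<phi> = Xd \<phi> - (A *v X \<phi> + B *v U \<phi>)" if "\<phi> \<in> H10_on \<tau>" for \<phi>
  proof -
    have c: "continuous_on {0..\<tau>} \<phi>"
      using that H1_onD(2)[of \<phi> \<tau>] by (simp add: H10_on_def)
    note int = integrable_continuous_scaleR[OF c]
    have lin: "integrable ?M (\<lambda>t. C *v (\<phi> t *\<^sub>R f t))"
      "(LINT t|?M. C *v (\<phi> t *\<^sub>R f t)) = C *v synthesis \<tau> f \<phi>"
      if "integrable ?M f" for C :: "real ^ 'k ^ 'n" and f
      unfolding synthesis_def
      using integrable_bounded_linear[OF matrix_vector_mul_bounded_linear int[OF that]]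
        integral_bounded_linear[OF matrix_vector_mul_bounded_linear int[OF that]] by auto
    have "synthesis \<tau> r \<phi> = (LINT t|?M. \<phi> t *\<^sub>R deriv_on \<tau> x t -
        (A *v (\<phi> t *\<^sub>R x t) + B *v (\<phi> t *\<^sub>R u t)))"
      by (simp add: synthesis_def r_def scaleR_right_diff_distrib scaleR_add_right
          matrix_vector_mult_scaleR)
    also have "\<dots> = synthesis \<tau> (deriv_on \<tau> x) \<phi> - (A *v X \<phi> + B *v U \<phi>)"
      using int[OF x'] lin[OF xi, of A] lin[OF u, of B] by (simp add: triple synthesis_def)
    also have "synthesis \<tau> (deriv_on \<tau> x) \<phi> = Xd \<phi>"
      using diff_synthesis_eq_synthesis_deriv_on[OF assms(1) x that] triple by simp
    finally show ?thesis .
  qed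
  have "(A, B) \<in> systems_of_data \<tau> (x, u) \<longleftrightarrow> (AE t in ?M. r t = 0)"
    by (simp add: systems_of_data_def r_def)
  also have "\<dots> \<longleftrightarrow> (\<forall>\<phi>\<in>H10_on \<tau>. synthesis \<tau> r \<phi> = 0)"
  proof
    assume ae: "AE t in ?M. r t = 0"
    have "synthesis \<tau> r \<phi> = 0" for \<phi>
      unfolding synthesis_def by (intro integral_eq_zero_AE eventually_mono[OF ae]) simp
    then show "\<forall>\<phi>\<in>H10_on \<tau>. synthesis \<tau> r \<phi> = 0" by blast
  qed (use AE_eq_0_if_synthesis_eq_0[OF assms(1) r] in blast)
  also have "\<dots> \<longleftrightarrow> (\<forall>\<phi>\<in>H10_on \<tau>. Xd \<phi> = A *v X \<phi> + B *v U \<phi>)"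
    using synth by simp
  finally show "(A, B) \<in> systems_of_data \<tau> (x, u) \<longleftrightarrow>
    (\<forall>\<phi>\<in>H10_on \<tau>. Xd \<phi> = A *v X \<phi> + B *v U \<phi>)" .
qed

end
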